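(* Fix $\epsilon\in(0,1]$. There exists a constant $c_\epsilon>0$, depending only on $\epsilon$, such that the following holds. Let $\pi$ be a strategy that does not know $u$ and that admits a moment-free distribution-free regret rate $\Phi_{free}$ with $\Phi_{free}(K,T)=o(T)$ as $T\to+\infty$ for every fixed $K\ge 2$. Then every distribution-dependent regret rate $\Phi_{dep}$ admitted by $\pi$ satisfies $$\liminf_{T\to+\infty}\frac{\Phi_{dep}(K,T)\,\Phi_{free}(K,T)^{\frac{1+\epsilon}{\epsilon}}}{T^{\frac{1+\epsilon}{\epsilon}}}\ \ge\ c_\epsilon\qquad\text{for all }K\ge 2 .$$
   Context: Bandit model. There are $K\ge 2$ arms and a horizon of $T\ge1$ rounds. An instance is a tuple $\underline\nu=(\nu_1,\dots,\nu_K)$ of probability distributions on $\mathbb R$. Successive pulls of arm $i$ produce i.i.d. rewards from $\nu_i$, independently across arms. At each round $t\in\{1,\dots,T\}$ the learner picks an arm $I_t\in\{1,\dots,K\}$ by a possibly randomized rule that depends only on the history up to round $t-1$, and observes a reward of the selected arm. A strategy $\pi$ specifies such a rule for every $K$ and $T$ (it may depend on $K$, $T$ and the fixed $\epsilon$). "Does not know $u$" means that the same strategy is used for all values of $u$. Heavy-tailed class. For $\epsilon\in(0,1]$ and $u>0$, $$\mathcal H_{\epsilon,u}=\{(\nu_1,\dots,\nu_K):\ \mathbb E_{X\sim\nu_i}[|X|^{1+\epsilon}]\le u\ \text{ for all } i\in\{1,\dots,K\}\}$$ (dependence on $K$ implicit). Regret. With $\mu_i=\mathbb E_{X\sim\nu_i}[X]$,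 $\mu^*=\max_i\mu_i$, $\Delta_i=\mu^*-\mu_i$ and $N_i(T)$ the number of pulls of arm $i$ in $T$ rounds, $$R_T^\pi(\underline\nu)=\mathbb E_{\underline\nu,\pi}\Big[\sum_{t=1}^T(\mu^*-\mu_{I_t})\Big]=\sum_{i=1}^K\Delta_i\,\mathbb E_{\underline\nu,\pi}[N_i(T)],$$ the expectation being over rewards and the strategy's internal randomness. Rates ($\epsilon$ fixed; $\Phi_{free},\Phi_{dep}$ are positive functions of $(K,T)$ that do not depend on $u$). - $\pi$ admits the moment-free distribution-free regret rate $\Phi_{free}$ if, without knowing $u$, $R_T^\pi(\underline\nu)\le u^{\frac1{1+\epsilon}}\Phi_{free}(K,T)$ for all $K\ge2$, $T\ge1$, $u>0$ and $\underline\nu\in\mathcal H_{\epsilon,u}$. - $\pi$ admits the distribution-dependent regret rate $\Phi_{dep}$ if, without knowing $u$, $\limsup_{T\to+\infty} R_T^\pi(\underline\nu)/\Phi_{dep}(K,T)\le\sum_{i:\Delta_i>0}\Delta_i$ for all $K\ge2$, $u>0$ and $\underline\nu\in\mathcal H_{\epsilon,u}$. *)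

theory Defs
  imports "HOL-Probability.Probability" "HOL-Library.Landau_Symbols"
begin

text \<open>
  Arms are \<open>{1..K}\<close> and rounds are \<open>{1..T}\<close>. A history up to round \<open>t\<close> maps each round
  \<open>s \<in> {1..t}\<close> to the pair (arm pulled, reward observed); it is extensional outside \<open>{1..t}\<close>.
\<close>

type_synonym history = "nat \<Rightarrow> nat \<times> real"

type_synonym rules = "nat \<Rightarrow> history \<Rightarrow> nat measure"

text \<open>
  A strategy maps \<open>K\<close>, \<open>T\<close>, the current round \<open>t\<close> and the history up to round \<open>t - 1\<close> to a
  distribution on the arms. As it has no access to \<open>u\<close>, the same strategy is used for all \<open>u\<close>.
\<close>

type_synonym strategy = "nat \<Rightarrow> nat \<Rightarrow> rules"

type_synonym bandit_instance = "nat \<Rightarrow> real measure"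

definition hist_space :: "nat \<Rightarrow> nat \<Rightarrow> history measure" where
  "hist_space K t = PiM {1..t} (\<lambda>_. count_space {1..K} \<Otimes>\<^sub>M borel)"

definition is_strategy :: "strategy \<Rightarrow> bool" where
  "is_strategy \<pi> \<longleftrightarrow>
     (\<forall>K\<ge>2. \<forall>T\<ge>1. \<forall>t\<in>{1..T}.
        \<pi> K T t \<in> hist_space K (t - 1) \<rightarrow>\<^sub>M prob_algebra (count_space {1..K}))"

definition pulls :: "nat \<Rightarrow> nat \<Rightarrow> history \<Rightarrow> nat" where
  "pulls i t h = card {s \<in> {1..t}. fst (h s) = i}"

text \<open>
  \<open>X (i, n)\<close> is the reward produced by the \<open>n\<close>-th pull of arm \<open>i\<close>. No arm is pulled more than
  \<open>T\<close> times, so \<open>n \<le> T\<close> suffices.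
\<close>

definition reward_table :: "nat \<Rightarrow> nat \<Rightarrow> bandit_instance \<Rightarrow> (nat \<times> nat \<Rightarrow> real) measure" where
  "reward_table K T \<nu> = PiM ({1..K} \<times> {1..T}) (\<lambda>(i, n). \<nu> i)"

text \<open>
  The law of the history up to round \<open>t\<close> for a fixed reward table \<open>X\<close>: the only randomness left
  is the internal randomization of the strategy, which sees \<open>X\<close> only through the history.
\<close>

primrec play :: "nat \<Rightarrow> rules \<Rightarrow> (nat \<times> nat \<Rightarrow> real) \<Rightarrow> nat \<Rightarrow> history measure" where
  "play K \<rho> X 0 = return (hist_space K 0) (\<lambda>_. undefined)"
| "play K \<rho> X (Suc t) =
     play K \<rho> X t \<bind> (\<lambda>h. \<rho> (Suc t) h \<bind> (\<lambda>i.
       return (hist_space K (Suc t)) (h(Suc t := (i, X (i, Suc (pulls i t h)))))))"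

definition hist_law :: "nat \<Rightarrow> nat \<Rightarrow> strategy \<Rightarrow> bandit_instance \<Rightarrow> history measure" where
  "hist_law K T \<pi> \<nu> = reward_table K T \<nu> \<bind> (\<lambda>X. play K (\<pi> K T) X T)"

definition arm_mean :: "bandit_instance \<Rightarrow> nat \<Rightarrow> real" where
  "arm_mean \<nu> i = (\<integral>x. x \<partial>\<nu> i)"

definition best_mean :: "nat \<Rightarrow> bandit_instance \<Rightarrow> real" where
  "best_mean K \<nu> = Max (arm_mean \<nu> ` {1..K})"

definition gap :: "nat \<Rightarrow> bandit_instance \<Rightarrow> nat \<Rightarrow> real" where
  "gap K \<nu> i = best_mean K \<nu> - arm_mean \<nu> i"

definition regret :: "nat \<Rightarrow> nat \<Rightarrow> strategy \<Rightarrow> bandit_instance \<Rightarrow> real" where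
  "regret K T \<pi> \<nu> =
     (\<integral>h. (\<Sum>t\<in>{1..T}. best_mean K \<nu> - arm_mean \<nu> (fst (h t))) \<partial>hist_law K T \<pi> \<nu>)"

text \<open>
  The moment is a nonnegative Lebesgue integral, so the bound by \<open>u\<close> includes its finiteness.
\<close>

definition heavy_tailed :: "real \<Rightarrow> real \<Rightarrow> nat \<Rightarrow> bandit_instance set" where
  "heavy_tailed \<epsilon> u K =
     {\<nu>. \<forall>i\<in>{1..K}. prob_space (\<nu> i) \<and> sets (\<nu> i) = sets borel \<and>
        (\<integral>\<^sup>+x. ennreal (\<bar>x\<bar> powr (1 + \<epsilon>)) \<partial>\<nu> i) \<le> ennreal u}"

definition positive_rate :: "(nat \<Rightarrow> nat \<Rightarrow> real) \<Rightarrow> bool" where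
  "positive_rate \<Phi> \<longleftrightarrow> (\<forall>K\<ge>2. \<forall>T\<ge>1. \<Phi> K T > 0)"

definition admits_free_rate :: "real \<Rightarrow> strategy \<Rightarrow> (nat \<Rightarrow> nat \<Rightarrow> real) \<Rightarrow> bool" where
  "admits_free_rate \<epsilon> \<pi> \<Phi> \<longleftrightarrow> positive_rate \<Phi> \<and>
     (\<forall>K\<ge>2. \<forall>T\<ge>1. \<forall>u>0. \<forall>\<nu>\<in>heavy_tailed \<epsilon> u K.
        regret K T \<pi> \<nu> \<le> u powr (1 / (1 + \<epsilon>)) * \<Phi> K T)"

definition admits_dep_rate :: "real \<Rightarrow> strategy \<Rightarrow> (nat \<Rightarrow> nat \<Rightarrow> real) \<Rightarrow> bool" where
  "admits_dep_rate \<epsilon> \<pi> \<Phi> \<longleftrightarrow> positive_rate \<Phi> \<and>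
     (\<forall>K\<ge>2. \<forall>u>0. \<forall>\<nu>\<in>heavy_tailed \<epsilon> u K.
        limsup (\<lambda>T. ereal (regret K T \<pi> \<nu> / \<Phi> K T))
          \<le> ereal (\<Sum>i | i \<in> {1..K} \<and> gap K \<nu> i > 0. gap K \<nu> i))"

end

theory Submission
  imports Defs
begin

text \<open>
  Let arm \<open>K\<close> always pay \<open>-1\<close> and all other arms \<open>0\<close>. The only gap is \<open>1\<close>, so the regret is the
  expected number \<open>m\<close> of pulls of arm \<open>K\<close>, and \<open>m < 2 * \<Phi>dep K T\<close> for large \<open>T\<close>.
  Now let \<open>n\<close> be about \<open>2 * m\<close> and let arm \<open>K\<close> pay, with probability \<open>\<gamma> = 1 / (2 * n)\<close>, a spike
  that raises its mean to \<open>1\<close>. With probability at least \<open>1 / 2\<close> the first \<open>n\<close> rewards of arm \<open>K\<close> show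
  no spike, and then, as long as it pulls arm \<open>K\<close> at most \<open>n\<close> times, the strategy behaves as before;
  by Markov's inequality it does so with probability at least \<open>1 / 2\<close>. Hence it suffers regret of order
  \<open>T\<close>. The moment of the spiked arm is of order \<open>n powr \<epsilon>\<close>, so the distribution-free rate gives
  \<open>T \<lesssim> n powr (\<epsilon> / (1 + \<epsilon>)) * \<Phi>free K T\<close>, which bounds \<open>n\<close>, hence \<open>m\<close> and \<open>\<Phi>dep\<close>, from below.
\<close>

section \<open>Measurability of pull counts, reward cells and history updates\<close>

text \<open>The measurable space shared by the reward tables of all instances, so that measurability
  of \<open>play\<close> in the table does not refer to the reward laws.\<close>

definition table_space :: "nat \<Rightarrow> nat \<Rightarrow> (nat \<times> nat \<Rightarrow> real) measure" where
  "table_space K T = PiM ({1..K} \<times> {1..T}) (\<lambda>_. borel)"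

lemma measurable_arm:
  assumes "s \<in> {1..t}"
  shows "(\<lambda>h. fst (h s)) \<in> hist_space K t \<rightarrow>\<^sub>M count_space {1..K}"
  unfolding hist_space_def
  by (rule measurable_compose[OF measurable_component_singleton[OF assms] measurable_fst])

lemma pulls_eq_sum: "pulls i t h = (\<Sum>s\<in>{1..t}. if fst (h s) = i then 1 else 0)"
  by (simp add: pulls_def sum.If_cases Int_def)

lemma pulls_le: "pulls i t h \<le> t"
  unfolding pulls_def by (rule order_trans[OF card_mono[of "{1..t}"]]) auto

lemma measurable_pulls: "pulls i t \<in> hist_space K t \<rightarrow>\<^sub>M count_space UNIV"
proof -
  have "(\<lambda>h. \<Sum>s\<in>{1..t}. if fst (h s) = i then 1 else 0 :: nat)
      \<in> hist_space K t \<rightarrow>\<^sub>M count_space UNIV"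
    by (rule measurable_sum_nat, rule measurable_compose[OF measurable_arm]) auto
  then show ?thesis by (simp add: pulls_eq_sum[abs_def])
qed

text \<open>Off the index set every table takes the value \<open>undefined\<close>, so the
  coordinate is constant there. Covering these indices lets the pull count be an arbitrary natural
  number in the cell that a round reads.\<close>

lemma measurable_cell: "(\<lambda>X. X c) \<in> borel_measurable (table_space K T)"
proof (cases "c \<in> {1..K} \<times> {1..T}")
  case True
  then show ?thesis unfolding table_space_def by (rule measurable_component_singleton)
next
  case False
  have "(\<lambda>X. X c) \<in> borel_measurable (table_space K T) \<longleftrightarrow>
      (\<lambda>X. undefined :: real) \<in> borel_measurable (table_space K T)"
    by (rule measurable_cong) (use PiE_arb[OF _ False] in \<open>unfold table_space_def space_PiM, blast\<close>)
  then show ?thesis by simp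
qed

definition extend :: "nat \<Rightarrow> (nat \<times> nat \<Rightarrow> real) \<Rightarrow> history \<Rightarrow> nat \<Rightarrow> history" where
  "extend t X h i = h(Suc t := (i, X (i, Suc (pulls i t h))))"

lemma play_Suc:
  "play K \<rho> X (Suc t) = play K \<rho> X t \<bind>
     (\<lambda>h. \<rho> (Suc t) h \<bind> (\<lambda>i. return (hist_space K (Suc t)) (extend t X h i)))"
  by (simp add: extend_def)

lemma pulls_extend: "pulls j (Suc t) (extend t X h i) = pulls j t h + (if i = j then 1 else 0)"
proof -
  have "pulls j t (extend t X h i) = pulls j t h"
    unfolding pulls_eq_sum extend_def by (rule sum.cong) auto
  then show ?thesis by (simp add: pulls_eq_sum extend_def)
qed

text \<open>The cell that is read depends on the arm and on its pull count. Both take countably many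
  values, so reading it is glued together from fixed cells.\<close>

lemma measurable_extend:
  "(\<lambda>((X, h), i). extend t X h i)
     \<in> (table_space K T \<Otimes>\<^sub>M hist_space K t) \<Otimes>\<^sub>M count_space {1..K} \<rightarrow>\<^sub>M hist_space K (Suc t)"
proof -
  let ?M = "(table_space K T \<Otimes>\<^sub>M hist_space K t) \<Otimes>\<^sub>M count_space {1..K}"
  have X: "(\<lambda>w. fst (fst w)) \<in> ?M \<rightarrow>\<^sub>M table_space K T"
    and h: "(\<lambda>w. snd (fst w)) \<in> ?M \<rightarrow>\<^sub>M hist_space K t"
    and i: "snd \<in> ?M \<rightarrow>\<^sub>M count_space {1..K}"
    by measurable
  have n: "(\<lambda>w. pulls (snd w) t (snd (fst w))) \<in> ?M \<rightarrow>\<^sub>M count_space UNIV"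
    by (rule measurable_compose_countable'[OF measurable_compose[OF h measurable_pulls] i]) auto
  have "(\<lambda>w. fst (fst w) (snd w, Suc (pulls (snd w) t (snd (fst w))))) \<in> borel_measurable ?M"
    by (rule measurable_compose_countable'[OF measurable_compose_countable'[OF
          measurable_compose[OF X measurable_cell] n] i]) auto
  with i have r: "(\<lambda>w. (snd w, fst (fst w) (snd w, Suc (pulls (snd w) t (snd (fst w))))))
      \<in> ?M \<rightarrow>\<^sub>M count_space {1..K} \<Otimes>\<^sub>M borel"
    by (rule measurable_Pair)
  show ?thesis
    unfolding hist_space_def split_beta extend_def
    by (rule measurable_fun_upd[where J = "{1..t}"])
       (use h r in \<open>auto simp: hist_space_def\<close>)
qed

lemma measurable_extend':
  assumes "X \<in> space (table_space K T)" "h \<in> space (hist_space K t)"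
  shows "extend t X h \<in> count_space {1..K} \<rightarrow>\<^sub>M hist_space K (Suc t)"
  using measurable_compose[OF measurable_Pair1'[of "(X, h)"] measurable_extend] assms
  by (simp add: space_pair_measure)

section \<open>The law of the history for a fixed reward table\<close>

lemma measurable_strategy:
  assumes "is_strategy \<pi>" "K \<ge> 2" "t < T"
  shows "\<pi> K T (Suc t) \<in> hist_space K t \<rightarrow>\<^sub>M prob_algebra (count_space {1..K})"
  using assms unfolding is_strategy_def
  by (metis Suc_le_eq atLeastAtMost_iff diff_Suc_1 le_add1 le_trans plus_1_eq_Suc not_less_eq_eq)

lemma measurable_step:
  assumes "is_strategy \<pi>" "K \<ge> 2" "t < T"
  shows "(\<lambda>(X, h). \<pi> K T (Suc t) h \<bind> (\<lambda>i. return (hist_space K (Suc t)) (extend t X h i)))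
     \<in> table_space K T \<Otimes>\<^sub>M hist_space K t \<rightarrow>\<^sub>M prob_algebra (hist_space K (Suc t))"
  unfolding split_beta
proof (rule measurable_bind_prob_space2[where N = "count_space {1..K}"])
  show "(\<lambda>w. \<pi> K T (Suc t) (snd w))
      \<in> table_space K T \<Otimes>\<^sub>M hist_space K t \<rightarrow>\<^sub>M prob_algebra (count_space {1..K})"
    by (rule measurable_compose[OF measurable_snd measurable_strategy[OF assms]])
  show "(\<lambda>(w, i). return (hist_space K (Suc t)) (extend t (fst w) (snd w) i))
      \<in> (table_space K T \<Otimes>\<^sub>M hist_space K t) \<Otimes>\<^sub>M count_space {1..K}
          \<rightarrow>\<^sub>M prob_algebra (hist_space K (Suc t))"
    using measurable_compose[OF measurable_extend measurable_return_prob_space]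
    by (simp add: split_beta)
qed

lemma measurable_play:
  assumes "is_strategy \<pi>" "K \<ge> 2" "t \<le> T"
  shows "(\<lambda>X. play K (\<pi> K T) X t) \<in> table_space K T \<rightarrow>\<^sub>M prob_algebra (hist_space K t)"
  using assms(3)
proof (induction t)
  case 0
  have "(\<lambda>_. undefined) \<in> space (hist_space K 0)"
    by (simp add: hist_space_def space_PiM)
  then show ?case
    by (simp add: measurable_const space_prob_algebra prob_space_return)
next
  case (Suc t)
  then show ?case
    using measurable_step[OF assms(1,2), of t T]
    by (auto simp: play_Suc simp del: play.simps intro!: measurable_bind_prob_space2[where N = "hist_space K t"])
qed

text \<open>Unfolding both binds of a round leaves the last arm choice innermost. Claims about
  \<open>play\<close> then follow by induction over rounds with the integrand generalized.\<close>

lemma nn_integral_play_Suc: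
  assumes "is_strategy \<pi>" "K \<ge> 2" "t < T"
    and X: "X \<in> space (table_space K T)"
    and f[measurable]: "f \<in> borel_measurable (hist_space K (Suc t))"
  shows "(\<integral>\<^sup>+h. f h \<partial>play K (\<pi> K T) X (Suc t)) =
     (\<integral>\<^sup>+h. \<integral>\<^sup>+i. f (extend t X h i) \<partial>\<pi> K T (Suc t) h \<partial>play K (\<pi> K T) X t)"
proof -
  let ?S = "\<lambda>h. \<pi> K T (Suc t) h \<bind> (\<lambda>i. return (hist_space K (Suc t)) (extend t X h i))"
  have play: "play K (\<pi> K T) X t \<in> space (prob_algebra (hist_space K t))"
    using measurable_space[OF measurable_play[OF assms(1,2)] X] assms(3) by simp
  then have sets_play: "sets (play K (\<pi> K T) X t) = sets (hist_space K t)"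
    by (simp add: space_prob_algebra)
  have S: "?S \<in> hist_space K t \<rightarrow>\<^sub>M subprob_algebra (hist_space K (Suc t))"
    using measurable_prob_algebraD[OF measurable_compose[OF measurable_Pair1'[OF X]
          measurable_step[OF assms(1-3)]]] by simp
  have "(\<integral>\<^sup>+h. f h \<partial>play K (\<pi> K T) X (Suc t)) =
      (\<integral>\<^sup>+h. \<integral>\<^sup>+h'. f h' \<partial>?S h \<partial>play K (\<pi> K T) X t)"
    unfolding play_Suc
    by (rule nn_integral_bind[OF f]) (simp add: S measurable_cong_sets[OF sets_play refl])
  also have "\<dots> = (\<integral>\<^sup>+h. \<integral>\<^sup>+i. f (extend t X h i) \<partial>\<pi> K T (Suc t) h \<partial>play K (\<pi> K T) X t)"
  proof (rule nn_integral_cong)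
    fix h assume "h \<in> space (play K (\<pi> K T) X t)"
    then have h: "h \<in> space (hist_space K t)"
      using sets_eq_imp_space_eq[OF sets_play] by simp
    have "\<pi> K T (Suc t) h \<in> space (prob_algebra (count_space {1..K}))"
      using measurable_space[OF measurable_strategy[OF assms(1-3)] h] .
    then have sets: "sets (\<pi> K T (Suc t) h) = sets (count_space {1..K})"
      by (simp add: space_prob_algebra)
    have e: "extend t X h \<in> \<pi> K T (Suc t) h \<rightarrow>\<^sub>M hist_space K (Suc t)"
      using measurable_extend'[OF X h] by (simp add: measurable_cong_sets[OF sets refl])
    have "(\<integral>\<^sup>+h'. f h' \<partial>?S h) =
        (\<integral>\<^sup>+i. \<integral>\<^sup>+h'. f h' \<partial>return (hist_space K (Suc t)) (extend t X h i) \<partial>\<pi> K T (Suc t) h)"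
      by (rule nn_integral_bind[OF f]) (rule measurable_compose[OF e return_measurable])
    also have "\<dots> = (\<integral>\<^sup>+i. f (extend t X h i) \<partial>\<pi> K T (Suc t) h)"
      by (intro nn_integral_cong nn_integral_return[OF _ f] measurable_space[OF e])
    finally show "(\<integral>\<^sup>+h'. f h' \<partial>?S h) = (\<integral>\<^sup>+i. f (extend t X h i) \<partial>\<pi> K T (Suc t) h)" .
  qed
  finally show ?thesis .
qed

text \<open>
  Two tables that differ only beyond the \<open>n\<close>-th reward of arm \<open>k\<close> cannot be told apart before the
  pull number \<open>n + 1\<close> of that arm; the last assumption discards all histories containing that pull.
\<close>

lemma nn_integral_play_cong_table:
  assumes "is_strategy \<pi>" "K \<ge> 2" "t \<le> T"
    and X: "X \<in> space (table_space K T)" and Y: "Y \<in> space (table_space K T)"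
    and other: "\<And>i s. i \<noteq> k \<Longrightarrow> X (i, s) = Y (i, s)"
    and first: "\<And>s. 1 \<le> s \<Longrightarrow> s \<le> n \<Longrightarrow> X (k, s) = Y (k, s)"
    and "f \<in> borel_measurable (hist_space K t)"
    and "\<And>h. pulls k t h > n \<Longrightarrow> f h = 0"
  shows "(\<integral>\<^sup>+h. f h \<partial>play K (\<pi> K T) X t) = (\<integral>\<^sup>+h. f h \<partial>play K (\<pi> K T) Y t)"
  using assms(3,8,9)
proof (induction t arbitrary: f)
  case 0
  then show ?case by simp
next
  case (Suc t)
  let ?g = "\<lambda>Z h. \<integral>\<^sup>+i. f (extend t Z h i) \<partial>\<pi> K T (Suc t) h"
  have t: "t < T" using Suc.prems by simp
  \<comment> \<open>A round can read different values only for arm \<open>k\<close> after at least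
    \<open>n\<close> earlier pulls. Its count then rises above \<open>n\<close>, where
    \<open>f\<close> is zero under both tables.\<close>
  have "f (extend t X h i) = f (extend t Y h i)" for h i
  proof (cases "i = k \<and> pulls k t h \<ge> n")
    case True
    then have "f (extend t Z h i) = 0" for Z
      by (intro Suc.prems(3)) (simp add: pulls_extend)
    then show ?thesis by simp
  next
    case False
    then have "X (i, Suc (pulls i t h)) = Y (i, Suc (pulls i t h))"
      by (cases "i = k") (auto intro: other first)
    then show ?thesis by (simp add: extend_def)
  qed
  then have "?g X = ?g Y" by simp
  \<comment> \<open>Pull counts never decrease, so averaging over the last arm keeps the vanishing
    condition and the induction hypothesis applies to \<open>?g Y\<close>.\<close>
  moreover have "?g Y h = 0" if "pulls k t h > n" for h
  proof -
    have "f (extend t Y h i) = 0" for i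
      using that by (intro Suc.prems(3)) (simp add: pulls_extend)
    then show ?thesis by simp
  qed
  moreover have "?g Y \<in> borel_measurable (hist_space K t)"
  proof (rule nn_integral_measurable_subprob_algebra2)
    show "\<pi> K T (Suc t) \<in> hist_space K t \<rightarrow>\<^sub>M subprob_algebra (count_space {1..K})"
      by (rule measurable_prob_algebraD[OF measurable_strategy[OF assms(1,2) t]])
    have "(\<lambda>w. ((Y, fst w), snd w)) \<in> hist_space K t \<Otimes>\<^sub>M count_space {1..K} \<rightarrow>\<^sub>M
        (table_space K T \<Otimes>\<^sub>M hist_space K t) \<Otimes>\<^sub>M count_space {1..K}"
      using Y by measurable
    from measurable_compose[OF measurable_compose[OF this measurable_extend] Suc.prems(2)]
    show "(\<lambda>(h, i). f (extend t Y h i))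
        \<in> borel_measurable (hist_space K t \<Otimes>\<^sub>M count_space {1..K})"
      by (simp add: split_beta)
  qed
  ultimately show ?case
    unfolding nn_integral_play_Suc[OF assms(1,2) t X Suc.prems(2)]
      nn_integral_play_Suc[OF assms(1,2) t Y Suc.prems(2)]
    using Suc.IH[of "?g Y"] t by simp
qed

section \<open>The law of the history for random rewards\<close>

definition valid_instance :: "nat \<Rightarrow> bandit_instance \<Rightarrow> bool" where
  "valid_instance K \<nu> \<longleftrightarrow> (\<forall>i\<in>{1..K}. prob_space (\<nu> i) \<and> sets (\<nu> i) = sets borel)"

lemma sets_reward_table:
  assumes "valid_instance K \<nu>"
  shows "sets (reward_table K T \<nu>) = sets (table_space K T)"
  unfolding reward_table_def table_space_def
  by (rule sets_PiM_cong) (use assms in \<open>auto simp: valid_instance_def\<close>)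

lemma hist_law_prob:
  assumes "is_strategy \<pi>" "K \<ge> 2" "valid_instance K \<nu>"
  shows "hist_law K T \<pi> \<nu> \<in> space (prob_algebra (hist_space K T))"
proof -
  have "prob_space (reward_table K T \<nu>)"
    unfolding reward_table_def
    by (rule prob_space_PiM) (use assms in \<open>auto simp: valid_instance_def\<close>)
  then have "reward_table K T \<nu> \<in> space (prob_algebra (table_space K T))"
    by (simp add: space_prob_algebra sets_reward_table[OF assms(3)])
  from prob_space_bind'[OF this measurable_play[OF assms(1,2)]]
    sets_bind'[OF this measurable_play[OF assms(1,2)]]
  show ?thesis
    by (simp add: hist_law_def space_prob_algebra)
qed

lemma nn_integral_hist_law:
  assumes "is_strategy \<pi>" "K \<ge> 2" "valid_instance K \<nu>"
    and f: "f \<in> borel_measurable (hist_space K T)"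
  shows "(\<integral>\<^sup>+h. f h \<partial>hist_law K T \<pi> \<nu>) =
    (\<integral>\<^sup>+X. \<integral>\<^sup>+h. f h \<partial>play K (\<pi> K T) X T \<partial>reward_table K T \<nu>)"
  unfolding hist_law_def
  by (rule nn_integral_bind[OF f])
     (simp add: measurable_prob_algebraD measurable_play[OF assms(1,2)]
       measurable_cong_sets[OF sets_reward_table[OF assms(3)] refl])

section \<open>Two-valued instances: means, moments and quiet tables\<close>

text \<open>One family for both instances of the argument: \<open>\<gamma> = 0\<close> makes arm
  \<open>K\<close> pay \<open>-1\<close> almost surely, while a small positive
  \<open>\<gamma>\<close> with a large \<open>x\<close> makes it the best arm.\<close>

definition spike_instance :: "nat \<Rightarrow> real \<Rightarrow> real \<Rightarrow> bandit_instance" where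
  "spike_instance K \<gamma> x i =
     (if i = K then distr (measure_pmf (bernoulli_pmf \<gamma>)) borel (\<lambda>b. if b then x else -1)
      else return borel 0)"

lemma spike_instance_prob:
  "prob_space (spike_instance K \<gamma> x i)" "sets (spike_instance K \<gamma> x i) = sets borel"
  by (auto simp: spike_instance_def prob_space_return intro!: measure_pmf.prob_space_distr)

lemma valid_spike_instance: "valid_instance K (spike_instance K \<gamma> x)"
  by (simp add: valid_instance_def spike_instance_prob)

lemma arm_mean_spike_instance:
  assumes "0 \<le> \<gamma>" "\<gamma> \<le> 1"
  shows "arm_mean (spike_instance K \<gamma> x) i = (if i = K then \<gamma> * x - (1 - \<gamma>) else 0)"
  using assms
  by (simp add: arm_mean_def spike_instance_def integral_distr integral_return)

lemma best_mean_spike_instance: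
  assumes "0 \<le> \<gamma>" "\<gamma> \<le> 1" "K \<ge> 2"
  shows "best_mean K (spike_instance K \<gamma> x) = max (\<gamma> * x - (1 - \<gamma>)) 0"
proof -
  have "arm_mean (spike_instance K \<gamma> x) ` {1..K} = {\<gamma> * x - (1 - \<gamma>), 0}"
  proof
    \<comment> \<open>As \<open>K \<ge> 2\<close>, arm \<open>1\<close> differs from arm
      \<open>K\<close> and attains the mean \<open>0\<close>.\<close>
    show "{\<gamma> * x - (1 - \<gamma>), 0} \<subseteq> arm_mean (spike_instance K \<gamma> x) ` {1..K}"
      using imageI[of K "{1..K}" "arm_mean (spike_instance K \<gamma> x)"]
        imageI[of 1 "{1..K}" "arm_mean (spike_instance K \<gamma> x)"] assms(3)
      by (simp add: arm_mean_spike_instance[OF assms(1,2)])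
  qed (auto simp: arm_mean_spike_instance[OF assms(1,2)])
  then show ?thesis by (simp add: best_mean_def)
qed

lemma spike_instance_heavy_tailed:
  assumes "0 \<le> \<gamma>" "\<gamma> \<le> 1" "0 \<le> x" "\<gamma> * x powr (1 + \<epsilon>) + (1 - \<gamma>) \<le> u"
  shows "spike_instance K \<gamma> x \<in> heavy_tailed \<epsilon> u K"
proof -
  have "(\<integral>\<^sup>+y. ennreal (\<bar>y\<bar> powr (1 + \<epsilon>)) \<partial>spike_instance K \<gamma> x K) =
      ennreal (x powr (1 + \<epsilon>)) * ennreal \<gamma> + ennreal (1 - \<gamma>)"
    using assms by (simp add: spike_instance_def nn_integral_distr)
  also have "\<dots> = ennreal (\<gamma> * x powr (1 + \<epsilon>) + (1 - \<gamma>))"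
    using assms by (simp flip: ennreal_mult ennreal_plus add: mult.commute)
  also have "\<dots> \<le> ennreal u" using assms(4) by (rule ennreal_leI)
  finally have "(\<integral>\<^sup>+y. ennreal (\<bar>y\<bar> powr (1 + \<epsilon>)) \<partial>spike_instance K \<gamma> x K) \<le> ennreal u" .
  moreover have "(\<integral>\<^sup>+y. ennreal (\<bar>y\<bar> powr (1 + \<epsilon>)) \<partial>spike_instance K \<gamma> x i) = 0" if "i \<noteq> K" for i
    using that by (simp add: spike_instance_def nn_integral_return)
  ultimately show ?thesis
    unfolding heavy_tailed_def using spike_instance_prob by fastforce
qed

text \<open>The reward table of the base instance \<open>spike_instance K 0 0\<close>, up to a null
  set. The restriction makes it extensional, hence a point of \<open>table_space\<close>.\<close>

definition quiet_table :: "nat \<Rightarrow> nat \<Rightarrow> nat \<times> nat \<Rightarrow> real" where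
  "quiet_table K T = restrict (\<lambda>(i, s). if i = K then -1 else 0) ({1..K} \<times> {1..T})"

lemma quiet_table_space: "quiet_table K T \<in> space (table_space K T)"
  by (simp add: quiet_table_def table_space_def space_PiM)

text \<open>A box, so that its probability factorizes. Fixing the other arms at \<open>0\<close>
  costs no probability; the rewards of arm \<open>K\<close> beyond the \<open>n\<close>-th stay
  free.\<close>

definition quiet_event :: "nat \<Rightarrow> nat \<Rightarrow> nat \<Rightarrow> (nat \<times> nat \<Rightarrow> real) set" where
  "quiet_event K T n =
     PiE ({1..K} \<times> {1..T}) (\<lambda>(i, s). if i = K then if s \<le> n then {-1} else UNIV else {0})"

lemma measure_quiet_event:
  assumes "0 \<le> \<gamma>" "\<gamma> \<le> 1" "0 \<le> x" "n \<le> T" "K \<ge> 1"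
  shows "quiet_event K T n \<in> sets (reward_table K T (spike_instance K \<gamma> x))"
    and "measure (reward_table K T (spike_instance K \<gamma> x)) (quiet_event K T n) = (1 - \<gamma>) ^ n"
proof -
  let ?I = "{1..K} \<times> {1..T}"
  let ?M = "\<lambda>(i, s :: nat). spike_instance K \<gamma> x i"
  let ?A = "\<lambda>(i, s). if i = K then if s \<le> n then {-1 :: real} else UNIV else {0}"
  have "product_prob_space ?M"
    by (rule product_prob_spaceI) (simp add: split_beta spike_instance_prob)
  then interpret finite_product_prob_space ?M ?I
    by (simp add: finite_product_prob_space_def finite_product_sigma_finite_def
        finite_product_sigma_finite_axioms_def product_prob_space_def)
  have A: "?A c \<in> sets (?M c)" for c
    by (auto simp: spike_instance_prob split: prod.split)
  show "quiet_event K T n \<in> sets (reward_table K T (spike_instance K \<gamma> x))"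
    unfolding quiet_event_def reward_table_def by (rule sets_PiM_I_finite) (use A in auto)
  have [simp]: "space (spike_instance K \<gamma> x i) = UNIV" for i
    using sets_eq_imp_space_eq[OF spike_instance_prob(2)] by simp
  \<comment> \<open>Since \<open>x \<ge> 0\<close>, the spike differs from \<open>-1\<close>, so the
    reward \<open>-1\<close> identifies the outcome without a spike.\<close>
  have "measure (spike_instance K \<gamma> x K) {-1} = measure (measure_pmf (bernoulli_pmf \<gamma>)) {False}"
    using assms(3) unfolding spike_instance_def
    by (auto simp: measure_distr vimage_def intro!: arg_cong2[where f = measure])
  then have K: "measure (spike_instance K \<gamma> x K) {-1} = 1 - \<gamma>"
    using assms by (simp add: measure_pmf_single)
  have "measure (?M c) (?A c) = (if c \<in> {K} \<times> {1..n} then 1 - \<gamma> else 1)" if "c \<in> ?I" for c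
  proof (cases c)
    case (Pair i s)
    have "measure (spike_instance K \<gamma> x i) UNIV = 1"
      using prob_space.prob_space[OF spike_instance_prob(1), of K \<gamma> x i] by simp
    moreover have "i \<noteq> K \<Longrightarrow> measure (spike_instance K \<gamma> x i) {0} = 1"
      by (simp add: spike_instance_def measure_return)
    ultimately show ?thesis using that K Pair by auto
  qed
  then have "(\<Prod>c\<in>?I. measure (?M c) (?A c)) = (\<Prod>c\<in>?I. if c \<in> {K} \<times> {1..n} then 1 - \<gamma> else 1)"
    by (intro prod.cong) auto
  also have "\<dots> = (\<Prod>c\<in>?I \<inter> {K} \<times> {1..n}. 1 - \<gamma>)"
    by (rule prod.inter_restrict[symmetric]) simp
  \<comment> \<open>All \<open>n\<close> restricted cells lie in the table because
    \<open>n \<le> T\<close>, so the exponent is exactly \<open>n\<close>.\<close>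
  also have "?I \<inter> {K} \<times> {1..n} = {K} \<times> {1..n}"
    using assms(4,5) by auto
  finally show "measure (reward_table K T (spike_instance K \<gamma> x)) (quiet_event K T n) = (1 - \<gamma>) ^ n"
    unfolding quiet_event_def reward_table_def
    by (subst prob_times) (use A in auto)
qed

text \<open>On \<open>quiet_event\<close> the inner integral is constant, since \<open>f\<close>
  ignores the histories that could reveal a difference from \<open>quiet_table\<close>. Dropping the
  complement leaves this constant times the probability of the event.\<close>

lemma nn_integral_hist_law_ge_quiet:
  assumes "is_strategy \<pi>" "K \<ge> 2" "n \<le> T" "0 \<le> \<gamma>" "\<gamma> \<le> 1" "0 \<le> x"
    and f: "f \<in> borel_measurable (hist_space K T)"
    and f0: "\<And>h. pulls K T h > n \<Longrightarrow> f h = 0"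
  shows "ennreal ((1 - \<gamma>) ^ n) * (\<integral>\<^sup>+h. f h \<partial>play K (\<pi> K T) (quiet_table K T) T)
     \<le> (\<integral>\<^sup>+h. f h \<partial>hist_law K T \<pi> (spike_instance K \<gamma> x))"
proof -
  let ?R = "reward_table K T (spike_instance K \<gamma> x)"
  let ?F = "\<lambda>X. \<integral>\<^sup>+h. f h \<partial>play K (\<pi> K T) X T"
  note E = measure_quiet_event[OF assms(4,5,6,3), of K]
  interpret prob_space ?R
    unfolding reward_table_def by (rule prob_space_PiM) (auto simp: spike_instance_prob)
  have "?F X = ?F (quiet_table K T)" if X: "X \<in> quiet_event K T n" for X
  proof (rule nn_integral_play_cong_table[OF assms(1,2) le_refl _ quiet_table_space _ _ f f0])
    show "X \<in> space (table_space K T)"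
      using X by (auto simp: quiet_event_def table_space_def space_PiM PiE_def)
    \<comment> \<open>Off the table, including \<open>s = 0\<close>, both sides are
      \<open>undefined\<close>.\<close>
    have "X (i, s) = quiet_table K T (i, s)" if "i = K \<Longrightarrow> s \<le> n" for i s
    proof (cases "(i, s) \<in> {1..K} \<times> {1..T}")
      case True
      then have "X (i, s) \<in> (if i = K then if s \<le> n then {-1} else UNIV else {0})"
        using PiE_mem[OF X[unfolded quiet_event_def] True] by simp
      then show ?thesis using True that by (auto simp: quiet_table_def split: if_splits)
    next
      case False
      then show ?thesis
        using PiE_arb[OF X[unfolded quiet_event_def] False] by (auto simp: quiet_table_def)
    qed
    then show "\<And>i s. i \<noteq> K \<Longrightarrow> X (i, s) = quiet_table K T (i, s)"
      and "\<And>s. 1 \<le> s \<Longrightarrow> s \<le> n \<Longrightarrow> X (K, s) = quiet_table K T (K, s)" by auto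
  qed
  then have "(\<integral>\<^sup>+X. ?F (quiet_table K T) * indicator (quiet_event K T n) X \<partial>?R)
      \<le> (\<integral>\<^sup>+X. ?F X \<partial>?R)"
    by (intro nn_integral_mono) (auto simp: indicator_def)
  moreover have "(\<integral>\<^sup>+X. ?F (quiet_table K T) * indicator (quiet_event K T n) X \<partial>?R)
      = ennreal ((1 - \<gamma>) ^ n) * ?F (quiet_table K T)"
    using E assms(2)
    by (subst nn_integral_cmult_indicator) (auto simp: emeasure_eq_measure mult.commute)
  ultimately show ?thesis
    by (simp add: nn_integral_hist_law[OF assms(1,2) valid_spike_instance f])
qed

section \<open>The regret of two-valued instances\<close>

text \<open>All arms but \<open>K\<close> have mean \<open>0\<close>, so only the pulls of arm
  \<open>K\<close> matter. The \<open>max\<close> serves both signs: the integrand is the pull count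
  for \<open>\<mu> = -1\<close> and \<open>T\<close> minus the pull count for
  \<open>\<mu> = 1\<close>. Nonnegativity makes the passage to \<open>ennreal\<close>
  lossless.\<close>

lemma regret_spike_instance:
  fixes \<gamma> x \<mu> :: real
  assumes "is_strategy \<pi>" "K \<ge> 2" "0 \<le> \<gamma>" "\<gamma> \<le> 1"
  defines "\<mu> \<equiv> \<gamma> * x - (1 - \<gamma>)"
  shows "ennreal (regret K T \<pi> (spike_instance K \<gamma> x)) =
    (\<integral>\<^sup>+h. ennreal (real T * max \<mu> 0 - \<mu> * real (pulls K T h)) \<partial>hist_law K T \<pi> (spike_instance K \<gamma> x))"
    and "0 \<le> regret K T \<pi> (spike_instance K \<gamma> x)"
proof -
  let ?L = "hist_law K T \<pi> (spike_instance K \<gamma> x)"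
  let ?f = "\<lambda>h. real T * max \<mu> 0 - \<mu> * real (pulls K T h)"
  have L: "?L \<in> space (prob_algebra (hist_space K T))"
    by (rule hist_law_prob[OF assms(1,2) valid_spike_instance])
  then interpret prob_space ?L by (simp add: space_prob_algebra)
  have sets: "sets ?L = sets (hist_space K T)" using L by (simp add: space_prob_algebra)
  have "(\<Sum>t\<in>{1..T}. best_mean K (spike_instance K \<gamma> x) - arm_mean (spike_instance K \<gamma> x) (fst (h t)))
      = ?f h" for h
    unfolding best_mean_spike_instance[OF assms(3,4,2)] arm_mean_spike_instance[OF assms(3,4)]
    by (simp add: sum_subtractf pulls_eq_sum \<mu>_def sum.If_cases)
  then have R: "regret K T \<pi> (spike_instance K \<gamma> x) = (\<integral>h. ?f h \<partial>?L)"
    by (simp add: regret_def)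
  have b: "0 \<le> ?f h \<and> ?f h \<le> T * \<bar>\<mu>\<bar>" for h
  proof -
    have "\<mu> \<ge> 0 \<Longrightarrow> \<mu> * pulls K T h \<le> \<mu> * T" "\<mu> \<ge> 0 \<Longrightarrow> 0 \<le> \<mu> * pulls K T h"
      "\<mu> \<le> 0 \<Longrightarrow> \<mu> * T \<le> \<mu> * pulls K T h" "\<mu> \<le> 0 \<Longrightarrow> \<mu> * pulls K T h \<le> 0"
      using pulls_le[of K T h] by (auto intro: mult_left_mono mult_left_mono_neg mult_nonpos_nonneg)
    then show ?thesis by (cases "\<mu> \<ge> 0") (auto simp: max_def mult.commute)
  qed
  have "?f \<in> borel_measurable (hist_space K T)"
    using measurable_compose[OF measurable_pulls, of "\<lambda>k. real T * max \<mu> 0 - \<mu> * real k" borel] by simp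
  then have "integrable ?L ?f"
    by (intro integrable_const_bound[where B = "T * \<bar>\<mu>\<bar>"])
       (use b in \<open>auto simp: measurable_cong_sets[OF sets refl]\<close>)
  from nn_integral_eq_integral[OF this]
  show "ennreal (regret K T \<pi> (spike_instance K \<gamma> x)) = (\<integral>\<^sup>+h. ennreal (?f h) \<partial>?L)"
    using b by (simp add: R)
  show "0 \<le> regret K T \<pi> (spike_instance K \<gamma> x)"
    unfolding R by (rule Bochner_Integration.integral_nonneg) (use b in blast)
qed

text \<open>By \<open>m\<close> and Markov's inequality, at most \<open>n\<close> pulls of arm
  \<open>K\<close> occur on the quiet table with probability at least \<open>1 / 2\<close>. Such
  histories cost at least \<open>T - n\<close> when arm \<open>K\<close> has mean \<open>1\<close>,
  and the quiet event transfers them at the price \<open>(1 - \<gamma>) ^ n\<close>.\<close>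

lemma regret_spike_instance_ge:
  assumes "is_strategy \<pi>" "K \<ge> 2" "n \<le> T" "0 \<le> \<gamma>" "\<gamma> \<le> 1" "0 \<le> x"
    and mean: "\<gamma> * x - (1 - \<gamma>) = 1"
    and m: "2 * regret K T \<pi> (spike_instance K 0 0) \<le> n + 1"
  shows "(1 - \<gamma>) ^ n * (real (T - n) / 2) \<le> regret K T \<pi> (spike_instance K \<gamma> x)"
proof -
  let ?Q = "play K (\<pi> K T) (quiet_table K T) T"
  let ?m = "regret K T \<pi> (spike_instance K 0 0)"
  have Q: "?Q \<in> space (prob_algebra (hist_space K T))"
    by (rule measurable_space[OF measurable_play[OF assms(1,2) le_refl] quiet_table_space])
  then interpret prob_space ?Q by (simp add: space_prob_algebra)
  have sets: "sets ?Q = sets (hist_space K T)" using Q by (simp add: space_prob_algebra)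
  note sp = sets_eq_imp_space_eq[OF sets]
  have pulls_Q: "pulls K T \<in> ?Q \<rightarrow>\<^sub>M count_space UNIV"
    using measurable_pulls by (simp add: measurable_cong_sets[OF sets refl])
  let ?A = "{h \<in> space ?Q. pulls K T h \<le> n}"
  have A: "?A \<in> sets ?Q" using pulls_Q by measurable
  \<comment> \<open>Markov's inequality at \<open>n + 1\<close>: an integer count above
    \<open>n\<close> is at least \<open>n + 1\<close>.\<close>
  have "ennreal (n + 1) * emeasure ?Q (space ?Q - ?A)
      = (\<integral>\<^sup>+h. ennreal (n + 1) * indicator (space ?Q - ?A) h \<partial>?Q)"
    using A by (simp add: nn_integral_cmult_indicator)
  also have "\<dots> \<le> (\<integral>\<^sup>+h. ennreal (pulls K T h) \<partial>?Q)"
    by (intro nn_integral_mono) (auto simp: indicator_def simp del: ennreal_plus intro!: ennreal_leI)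
  \<comment> \<open>For \<open>\<gamma> = 0\<close> and cutoff \<open>T\<close> the quiet factor is
    \<open>1\<close>, and no history has more than \<open>T\<close> pulls.\<close>
  also have "\<dots> \<le> (\<integral>\<^sup>+h. ennreal (pulls K T h) \<partial>hist_law K T \<pi> (spike_instance K 0 0))"
    using nn_integral_hist_law_ge_quiet[OF assms(1,2) le_refl, of 0 0 "\<lambda>h. ennreal (pulls K T h)"]
      measurable_compose[OF measurable_pulls, of "\<lambda>k. ennreal (real k)" borel] leD[OF pulls_le]
    by simp
  also have "\<dots> = ennreal ?m"
    using regret_spike_instance(1)[OF assms(1,2), where \<gamma> = 0 and x = 0 and T = T] by simp
  finally have "ennreal (real (n + 1) * prob (space ?Q - ?A)) \<le> ennreal ?m"
    by (simp add: emeasure_eq_measure ennreal_mult)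
  then have "real (n + 1) * prob (space ?Q - ?A) \<le> ?m"
    using regret_spike_instance(2)[OF assms(1,2), where \<gamma> = 0 and x = 0 and T = T]
    by (subst (asm) ennreal_le_iff) simp_all
  also have "?m \<le> (n + 1) / 2" using m by simp
  finally have "real (n + 1) * prob (space ?Q - ?A) \<le> real (n + 1) * (1 / 2)" by simp
  then have "prob (space ?Q - ?A) \<le> 1 / 2"
    by (subst (asm) mult_le_cancel_left_pos) auto
  then have pA: "1 / 2 \<le> prob ?A" using prob_compl[OF A] by simp
  \<comment> \<open>A lower bound for the regret integrand that vanishes above \<open>n\<close>
    pulls, as the transfer requires.\<close>
  let ?f = "\<lambda>h. ennreal (T - n) * indicator {h \<in> space (hist_space K T). pulls K T h \<le> n} h"
  have fm: "?f \<in> borel_measurable (hist_space K T)"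
    using A by (intro borel_measurable_times_ennreal borel_measurable_indicator) (simp_all add: sets sp)
  have "ennreal ((1 - \<gamma>) ^ n * (real (T - n) / 2)) \<le> ennreal ((1 - \<gamma>) ^ n * (real (T - n) * prob ?A))"
    using pA assms(5) mult_left_mono[OF pA, of "real (T - n)"]
    by (intro ennreal_leI mult_left_mono) auto
  also have "\<dots> = ennreal ((1 - \<gamma>) ^ n) * (\<integral>\<^sup>+h. ?f h \<partial>?Q)"
    using A assms(5)
    by (simp add: nn_integral_cmult_indicator emeasure_eq_measure ennreal_mult sp)
  also have "\<dots> \<le> (\<integral>\<^sup>+h. ?f h \<partial>hist_law K T \<pi> (spike_instance K \<gamma> x))"
    by (rule nn_integral_hist_law_ge_quiet[OF assms(1-6) fm]) auto
  also have "\<dots> \<le> (\<integral>\<^sup>+h. ennreal (real T - pulls K T h) \<partial>hist_law K T \<pi> (spike_instance K \<gamma> x))"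
    by (intro nn_integral_mono) (auto simp: indicator_def of_nat_diff assms(3) intro!: ennreal_leI)
  also have "\<dots> = ennreal (regret K T \<pi> (spike_instance K \<gamma> x))"
    using regret_spike_instance(1)[OF assms(1,2,4,5), where x = x and T = T] by (simp add: mean)
  finally show ?thesis
    using regret_spike_instance(2)[OF assms(1,2,4,5), where x = x and T = T] by simp
qed


section \<open>Consequences of the two rates for the base instance\<close>

text \<open>The rewards have modulus at most \<open>1\<close>, so \<open>u = 1\<close> is admissible
  and the moment factor is \<open>1\<close>.\<close>

lemma base_regret_le_free_rate:
  assumes "is_strategy \<pi>" "K \<ge> 2" "T \<ge> 1" "admits_free_rate \<epsilon> \<pi> \<Phi>"
  shows "regret K T \<pi> (spike_instance K 0 0) \<le> \<Phi> K T"
proof -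
  have "spike_instance K 0 0 \<in> heavy_tailed \<epsilon> 1 K"
    by (rule spike_instance_heavy_tailed) auto
  then have "regret K T \<pi> (spike_instance K 0 0) \<le> 1 powr (1 / (1 + \<epsilon>)) * \<Phi> K T"
    using assms zero_less_one unfolding admits_free_rate_def by blast
  then show ?thesis by simp
qed

text \<open>The free rate caps the regret of a spiked instance tuned to the base regret, while that
  regret is at least \<open>T / 8\<close>. The exponent \<open>q\<close> is the reciprocal of
  \<open>\<epsilon> / (1 + \<epsilon>)\<close> and solves the resulting inequality for
  \<open>n\<close>.\<close>

lemma base_regret_ge:
  fixes \<epsilon> :: real and \<Phi> :: "nat \<Rightarrow> nat \<Rightarrow> real"
  defines "q \<equiv> (1 + \<epsilon>) / \<epsilon>"
  assumes \<epsilon>: "0 < \<epsilon>" "\<epsilon> \<le> 1"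
    and \<pi>: "is_strategy \<pi>" "K \<ge> 2" "T \<ge> 8" "admits_free_rate \<epsilon> \<pi> \<Phi>"
    and small: "\<Phi> K T \<le> T / 8"
  shows "(T / (72 * \<Phi> K T)) powr q \<le> 2 * regret K T \<pi> (spike_instance K 0 0) + 2"
proof -
  define m where "m = regret K T \<pi> (spike_instance K 0 0)"
  \<comment> \<open>Large enough for Markov's inequality, within \<open>2\<close> of
    \<open>2 * m\<close>, and positive so that \<open>\<gamma>\<close> makes sense.\<close>
  define n where "n = nat \<lceil>2 * m\<rceil> + 1"
  define \<gamma> where "\<gamma> = 1 / (2 * real n)"
  \<comment> \<open>The solution of \<open>\<gamma> * x - (1 - \<gamma>) = 1\<close>.\<close>
  define x where "x = 4 * real n - 1"
  have \<Phi>: "\<Phi> K T > 0"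
    using \<pi> by (auto simp: admits_free_rate_def positive_rate_def)
  have m0: "0 \<le> m"
    unfolding m_def using regret_spike_instance(2)[OF \<pi>(1,2), of 0] by simp
  have m\<Phi>: "m \<le> \<Phi> K T"
    unfolding m_def using \<pi> by (intro base_regret_le_free_rate) auto
  have n1: "1 \<le> real n" and n2: "2 * m \<le> n" and n3: "n \<le> 2 * m + 2"
    unfolding n_def using m0 by linarith+
  \<comment> \<open>Here \<open>n \<le> 2 * \<Phi> K T + 2 \<le> T / 4 + T / 4\<close>, the last
    summand by \<open>T \<ge> 8\<close>.\<close>
  have nT: "real n \<le> T / 2" using n3 m\<Phi> small \<pi>(3) by linarith
  then have "n \<le> T" by linarith
  have \<gamma>: "0 \<le> \<gamma>" "\<gamma> \<le> 1" using n1 by (auto simp: \<gamma>_def)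
  have x: "0 \<le> x" using n1 by (simp add: x_def)
  have mean: "\<gamma> * x - (1 - \<gamma>) = 1" using n1 by (simp add: \<gamma>_def x_def field_simps)
  have "1 + real n * (- \<gamma>) \<le> (1 + (- \<gamma>)) ^ n"
    by (rule Bernoulli_inequality) (use \<gamma> in simp)
  then have quiet: "1 / 2 \<le> (1 - \<gamma>) ^ n" using n1 by (simp add: \<gamma>_def)
  \<comment> \<open>The spike contributes at most \<open>8 * n powr \<epsilon>\<close> to the
    moment, and the outcome \<open>-1\<close> at most \<open>1 \<le> n powr \<epsilon>\<close>,
    hence the factor \<open>9\<close>.\<close>
  have "x powr (1 + \<epsilon>) \<le> (4 * real n) powr (1 + \<epsilon>)"
    using x \<epsilon> by (intro powr_mono2) (auto simp: x_def)
  also have "\<dots> = 4 * real n * (4 powr \<epsilon> * real n powr \<epsilon>)"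
    using n1 by (simp add: powr_add powr_mult)
  finally have "\<gamma> * x powr (1 + \<epsilon>) \<le> \<gamma> * (4 * real n * (4 powr \<epsilon> * real n powr \<epsilon>))"
    using \<gamma> by (intro mult_left_mono) auto
  also have "\<dots> = 2 * (4 powr \<epsilon> * real n powr \<epsilon>)" using n1 by (simp add: \<gamma>_def)
  also have "\<dots> \<le> 2 * (4 * real n powr \<epsilon>)"
    using powr_mono[of \<epsilon> 1 "4::real"] \<epsilon> by (intro mult_left_mono mult_right_mono) auto
  moreover have "1 \<le> real n powr \<epsilon>" using n1 \<epsilon> by (simp add: ge_one_powr_ge_zero)
  ultimately have "\<gamma> * x powr (1 + \<epsilon>) + (1 - \<gamma>) \<le> 9 * real n powr \<epsilon>"
    using \<gamma> by linarith
  then have ht: "spike_instance K \<gamma> x \<in> heavy_tailed \<epsilon> (9 * real n powr \<epsilon>) K"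
    by (rule spike_instance_heavy_tailed[OF \<gamma> x])
  \<comment> \<open>The factors are \<open>1 / 2\<close> for the quiet event, \<open>1 / 2\<close>
    from Markov's inequality, and \<open>T - n \<ge> T / 2\<close>.\<close>
  have "T / 8 \<le> 1 / 2 * (real (T - n) / 2)"
    using nT by (simp add: of_nat_diff \<open>n \<le> T\<close>)
  also have "\<dots> \<le> (1 - \<gamma>) ^ n * (real (T - n) / 2)"
    using quiet by (intro mult_right_mono) auto
  also have "\<dots> \<le> regret K T \<pi> (spike_instance K \<gamma> x)"
    by (rule regret_spike_instance_ge[OF \<pi>(1,2) \<open>n \<le> T\<close> \<gamma> x mean]) (use n2 m_def in simp)
  also have "\<dots> \<le> (9 * real n powr \<epsilon>) powr (1 / (1 + \<epsilon>)) * \<Phi> K T"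
    using \<pi> ht n1 by (auto simp: admits_free_rate_def)
  also have "(9 * real n powr \<epsilon>) powr (1 / (1 + \<epsilon>)) = 9 powr (1 / (1 + \<epsilon>)) * real n powr (\<epsilon> / (1 + \<epsilon>))"
    by (simp add: powr_mult powr_powr)
  also have "\<dots> \<le> 9 * real n powr (\<epsilon> / (1 + \<epsilon>))"
    using powr_mono[of "1 / (1 + \<epsilon>)" 1 "9::real"] \<epsilon> by (intro mult_right_mono) auto
  finally have "T / 8 \<le> 9 * real n powr (\<epsilon> / (1 + \<epsilon>)) * \<Phi> K T"
    using \<Phi> by simp
  \<comment> \<open>The constant is \<open>72 = 8 * 9\<close>.\<close>
  then have "T / (72 * \<Phi> K T) \<le> real n powr (\<epsilon> / (1 + \<epsilon>))"
    using \<Phi> by (simp add: field_simps)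
  then have "(T / (72 * \<Phi> K T)) powr q \<le> (real n powr (\<epsilon> / (1 + \<epsilon>))) powr q"
    using \<Phi> \<epsilon> by (intro powr_mono2) (auto simp: q_def)
  also have "\<dots> = n" using n1 \<epsilon> by (simp add: powr_powr q_def)
  finally show ?thesis using n3 by (simp add: m_def)
qed

text \<open>Arm \<open>K\<close> is the only suboptimal arm and has gap \<open>1\<close>, so the
  limsup is at most \<open>1\<close>. The slack up to \<open>2\<close> turns this into an eventual
  strict bound.\<close>

lemma base_regret_less_dep_rate:
  assumes "is_strategy \<pi>" "K \<ge> 2" "admits_dep_rate \<epsilon> \<pi> \<Phi>"
  shows "\<forall>\<^sub>F T in sequentially. regret K T \<pi> (spike_instance K 0 0) < 2 * \<Phi> K T"
proof -
  let ?\<nu> = "spike_instance K 0 0"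
  have ht: "?\<nu> \<in> heavy_tailed \<epsilon> 1 K"
    by (rule spike_instance_heavy_tailed) auto
  have gap: "gap K ?\<nu> i = (if i = K then 1 else 0)" for i
    using assms(2) by (simp add: gap_def best_mean_spike_instance arm_mean_spike_instance)
  have gaps: "{i. i \<in> {1..K} \<and> gap K ?\<nu> i > 0} = {K}"
    using assms(2) by (auto simp: gap)
  from ht have "limsup (\<lambda>T. ereal (regret K T \<pi> ?\<nu> / \<Phi> K T))
      \<le> ereal (\<Sum>i | i \<in> {1..K} \<and> gap K ?\<nu> i > 0. gap K ?\<nu> i)"
    using assms zero_less_one unfolding admits_dep_rate_def by blast
  also have "\<dots> = ereal 1"
    using gaps by (simp only:) (simp add: gap)
  also have "ereal 1 < ereal 2" by simp
  finally have "\<forall>\<^sub>F T in sequentially. ereal (regret K T \<pi> ?\<nu> / \<Phi> K T) < ereal 2"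
    by (rule Limsup_lessD)
  then show ?thesis
    using eventually_ge_at_top[of 1]
  proof eventually_elim
    case (elim T)
    moreover have "\<Phi> K T > 0"
      using assms elim by (auto simp: admits_dep_rate_def positive_rate_def)
    ultimately show ?case by (simp add: divide_less_eq)
  qed
qed

theorem theorem4:
  fixes \<epsilon> :: real
  assumes "0 < \<epsilon>" and "\<epsilon> \<le> 1"
  shows "\<exists>c>0. \<forall>(\<pi> :: strategy) (\<Phi>free :: nat \<Rightarrow> nat \<Rightarrow> real) (\<Phi>dep :: nat \<Rightarrow> nat \<Rightarrow> real).
           is_strategy \<pi> \<longrightarrow>
           admits_free_rate \<epsilon> \<pi> \<Phi>free \<longrightarrow>
           (\<forall>K\<ge>2. (\<lambda>T. \<Phi>free K T) \<in> o(\<lambda>T. real T)) \<longrightarrow>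
           admits_dep_rate \<epsilon> \<pi> \<Phi>dep \<longrightarrow>
           (\<forall>K\<ge>2. liminf (\<lambda>T. ereal (\<Phi>dep K T * \<Phi>free K T powr ((1 + \<epsilon>) / \<epsilon>)
                                     / real T powr ((1 + \<epsilon>) / \<epsilon>))) \<ge> ereal c)"
proof -
  define q where "q = (1 + \<epsilon>) / \<epsilon>"
  have q: "2 \<le> q" using assms by (simp add: q_def field_simps)
  \<comment> \<open>The \<open>72\<close> comes from \<open>base_regret_ge\<close>. The
    \<open>8\<close> combines a factor \<open>2\<close> for absorbing its additive \<open>2\<close>,
    a factor \<open>2\<close> for its \<open>2 * regret\<close>, and a factor \<open>2\<close> from
    the dependent rate.\<close>
  define c where "c = 1 / (8 * 72 powr q)"
  have c: "c > 0" by (simp add: c_def)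
  have "ereal c \<le> liminf (\<lambda>T. ereal (\<Phi>dep K T * \<Phi>free K T powr q / real T powr q))"
    if \<pi>: "is_strategy \<pi>" and free: "admits_free_rate \<epsilon> \<pi> \<Phi>free"
      and small: "\<forall>K\<ge>2. (\<lambda>T. \<Phi>free K T) \<in> o(\<lambda>T. real T)"
      and dep: "admits_dep_rate \<epsilon> \<pi> \<Phi>dep" and K: "K \<ge> 2"
    for \<pi> \<Phi>free \<Phi>dep K
  proof (rule Liminf_bounded)
    \<comment> \<open>The bound \<open>1 / 144\<close> makes
      \<open>T / (72 * \<Phi>free K T)\<close> at least \<open>2\<close>, so its power
      \<open>q\<close> is at least \<open>4\<close>; it also gives the smallness required by
      \<open>base_regret_ge\<close>.\<close>
    have "\<forall>\<^sub>F T in sequentially. norm (\<Phi>free K T) \<le> 1 / 144 * norm (real T)"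
      using small K by (intro landau_o.smallD) auto
    then show "\<forall>\<^sub>F T in sequentially.
        ereal c \<le> ereal (\<Phi>dep K T * \<Phi>free K T powr q / real T powr q)"
      using base_regret_less_dep_rate[OF \<pi> K dep] eventually_ge_at_top[of 8]
    proof eventually_elim
      case (elim T)
      let ?m = "regret K T \<pi> (spike_instance K 0 0)" and ?\<Phi> = "\<Phi>free K T"
      have \<Phi>: "?\<Phi> > 0"
        using free K elim by (auto simp: admits_free_rate_def positive_rate_def)
      have \<Phi>T: "144 * ?\<Phi> \<le> T" using elim(1) \<Phi> by simp
      have "2 \<le> T / (72 * ?\<Phi>)" using \<Phi> \<Phi>T by (simp add: field_simps)
      then have "2 powr q \<le> (T / (72 * ?\<Phi>)) powr q"
        using q by (intro powr_mono2) auto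
      moreover have "4 \<le> (2 :: real) powr q"
        using powr_mono[OF q, of "2 :: real"] by simp
      moreover have "(T / (72 * ?\<Phi>)) powr q \<le> 2 * ?m + 2"
        unfolding q_def using \<Phi> \<Phi>T elim(3)
        by (intro base_regret_ge assms \<pi> K free) auto
      \<comment> \<open>With \<open>P\<close> for the power, \<open>P \<ge> 4\<close> gives
        \<open>2 * ?m \<ge> P - 2 \<ge> P / 2\<close>, and \<open>\<Phi>dep K T\<close> exceeds
        \<open>?m / 2\<close>.\<close>
      ultimately have "(T / (72 * ?\<Phi>)) powr q / 8 \<le> \<Phi>dep K T" using elim(2) by linarith
      then have "(T / (72 * ?\<Phi>)) powr q / 8 * (?\<Phi> powr q / T powr q)
          \<le> \<Phi>dep K T * (?\<Phi> powr q / T powr q)"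
        by (intro mult_right_mono) auto
      also have "(T / (72 * ?\<Phi>)) powr q / 8 * (?\<Phi> powr q / T powr q) = c"
        using \<Phi> elim(3) by (simp add: c_def powr_divide powr_mult)
      finally show ?case by simp
    qed
  qed
  with c show ?thesis unfolding q_def by blast
qed

end
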